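(* Let $x^v$ be (the $x$-part of) a solution to the relaxed master problem (RMP), and let $\mathcal I^v=\{i\in\{1,\dots,n_1\}:x^v_i=1\}$. Then $x=x^v$ violates the inequality $$\sum_{i\in\mathcal I^v}x_i-\sum_{i\notin\mathcal I^v}x_i\le|\mathcal I^v|-1.$$ Furthermore, the inequality is satisfied by any $x^l\in\mathcal X$ with $x^l\ne x^v$.
   Context: Assumption: $\mathcal X=\{0,1\}^{n_1}$. $(\mathcal X_d)_{d\in\mathcal D}$ is a finite partition of $\mathcal X$ and $c\in\mathbb R^{n_1}$. (RMP): given finite sets $\underline{\mathcal F_d},\underline{\mathcal O_d}$ of real-valued functions on $\mathcal X$ ($d\in\mathcal D$), minimize $c^\top x+\mu$ over $x\in\mathcal X$, $\mu\in\mathbb R$ subject to, for every $d\in\mathcal D$: if $x\in\mathcal X_d$ then $f(x)\le0$ for all $f\in\underline{\mathcal F_d}$ and $o(x)\le\mu$ for all $o\in\underline{\mathcal O_d}$. In particular the $x$-part of any solution lies in $\{0,1\}^{n_1}$. *)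

theory Defs
  imports "HOL-Analysis.Analysis"
begin

definition binary_vectors :: "(real ^ 'n) set" where
  "binary_vectors = {x. \<forall>i. x $ i \<in> {0, 1}}"

text \<open>Injectivity turns the library's notion for sets of blocks into one for indexed families:
  the blocks \<open>Xs d\<close> with \<open>d \<in> D\<close> are nonempty, pairwise disjoint and cover \<open>X\<close>.\<close>

definition indexed_partition :: "'a set \<Rightarrow> 'd set \<Rightarrow> ('d \<Rightarrow> 'a set) \<Rightarrow> bool" where
  "indexed_partition X D Xs \<longleftrightarrow> inj_on Xs D \<and> partition_on X (Xs ` D)"

text \<open>Real-valued functions on binary vectors are represented by total functions on
  \<^typ>\<open>real ^ 'n\<close>; their values at other vectors are never used.\<close>

definition rmp_feasible ::
  "'d set \<Rightarrow> ('d \<Rightarrow> (real ^ 'n) set) \<Rightarrow> ('d \<Rightarrow> (real ^ 'n \<Rightarrow> real) set)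
    \<Rightarrow> ('d \<Rightarrow> (real ^ 'n \<Rightarrow> real) set) \<Rightarrow> (real ^ 'n) \<times> real \<Rightarrow> bool" where
  "rmp_feasible D Xs F O' = (\<lambda>(x, \<mu>).
     x \<in> binary_vectors \<and>
     (\<forall>d\<in>D. x \<in> Xs d \<longrightarrow> (\<forall>f\<in>F d. f x \<le> 0) \<and> (\<forall>g\<in>O' d. g x \<le> \<mu>)))"

definition rmp_solution ::
  "real ^ 'n \<Rightarrow> 'd set \<Rightarrow> ('d \<Rightarrow> (real ^ 'n) set) \<Rightarrow> ('d \<Rightarrow> (real ^ 'n \<Rightarrow> real) set)
    \<Rightarrow> ('d \<Rightarrow> (real ^ 'n \<Rightarrow> real) set) \<Rightarrow> (real ^ 'n) \<times> real \<Rightarrow> bool" where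
  "rmp_solution c D Xs F O' = is_arg_min (\<lambda>(x, \<mu>). c \<bullet> x + \<mu>) (rmp_feasible D Xs F O')"

end

theory Submission
  imports Defs
begin

text \<open>On binary vectors the left-hand side of the cut is an affine function of the Hamming distance
  to \<open>xv\<close>: it equals \<open>card Iv\<close> minus the number of coordinates in which the argument differs
  from \<open>xv\<close> (lemma \<open>cut_lhs_eq_card_minus_hamming\<close>). At \<open>xv\<close> itself the distance is \<open>0\<close>, so the
  bound \<open>card Iv - 1\<close> is exceeded by one; at any other binary vector the distance is a positive
  integer, hence at least \<open>1\<close>, and the bound holds. That \<open>xv\<close> is binary comes from
  feasibility in the master problem (\<open>rmp_solution_binary\<close>).\<close>

lemma rmp_solution_binary:
  assumes "rmp_solution c D Xs F O' (x, \<mu>)"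
  shows "x \<in> binary_vectors"
  using assms by (auto simp: rmp_solution_def is_arg_min_def rmp_feasible_def)

text \<open>Flipping a coordinate of \<open>v\<close> lowers the left-hand side by exactly \<open>1\<close>: a flip inside the
  support loses a positive term, a flip outside it gains a negative one.\<close>

lemma cut_lhs_eq_card_minus_hamming:
  fixes v x :: "real ^ 'n"
  assumes v: "v \<in> binary_vectors" and x: "x \<in> binary_vectors" and I: "I = {i. v $ i = 1}"
  shows "(\<Sum>i\<in>I. x $ i) - (\<Sum>i\<in>- I. x $ i) = real (card I) - real (card {i. x $ i \<noteq> v $ i})"
proof -
  let ?\<delta> = "\<lambda>i. if x $ i \<noteq> v $ i then 1 else 0 :: real"
  have v01: "v $ i = 0 \<or> v $ i = 1" and x01: "x $ i = 0 \<or> x $ i = 1" for i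
    using v x by (auto simp: binary_vectors_def)
  have inside: "(\<Sum>i\<in>I. x $ i) = (\<Sum>i\<in>I. 1 - ?\<delta> i)"
    by (rule sum.cong) (use x01 in \<open>auto simp: I\<close>)
  have outside: "(\<Sum>i\<in>- I. x $ i) = (\<Sum>i\<in>- I. ?\<delta> i)"
    by (rule sum.cong) (use v01 x01 in \<open>force simp: I\<close>)+
  have "real (card {i. x $ i \<noteq> v $ i}) = (\<Sum>i\<in>UNIV. ?\<delta> i)"
    by (simp add: sum.If_cases)
  also have "\<dots> = (\<Sum>i\<in>I. ?\<delta> i) + (\<Sum>i\<in>- I. ?\<delta> i)"
    by (subst sum.union_disjoint [symmetric]) (auto simp: Compl_partition)
  finally show ?thesis
    unfolding inside outside by (simp add: sum_subtractf)
qed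

theorem theorem9:
  fixes c xv :: "real ^ 'n"
    and \<mu>v :: real
    and D :: "'d set"
    and Xs :: "'d \<Rightarrow> (real ^ 'n) set"
    and F O' :: "'d \<Rightarrow> (real ^ 'n \<Rightarrow> real) set"
    and Iv :: "'n set"
  assumes "finite D"
    and "indexed_partition binary_vectors D Xs"
    and "\<And>d. d \<in> D \<Longrightarrow> finite (F d)"
    and "\<And>d. d \<in> D \<Longrightarrow> finite (O' d)"
    and "rmp_solution c D Xs F O' (xv, \<mu>v)"
    and "Iv = {i. xv $ i = 1}"
  shows "\<not> ((\<Sum>i\<in>Iv. xv $ i) - (\<Sum>i\<in>- Iv. xv $ i) \<le> real (card Iv) - 1) \<and>
    (\<forall>xl\<in>binary_vectors. xl \<noteq> xv \<longrightarrow>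
       (\<Sum>i\<in>Iv. xl $ i) - (\<Sum>i\<in>- Iv. xl $ i) \<le> real (card Iv) - 1)"
proof -
  have xv: "xv \<in> binary_vectors"
    using assms(5) by (rule rmp_solution_binary)
  note cut_lhs = cut_lhs_eq_card_minus_hamming [OF xv _ assms(6)]
  have "1 \<le> card {i. xl $ i \<noteq> xv $ i}" if "xl \<noteq> xv" for xl
    using that by (auto simp: vec_eq_iff Suc_le_eq card_gt_0_iff)
  then show ?thesis
    by (auto simp: cut_lhs xv)
qed

end
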